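(* For each $n\geq 1$, $$\max_{w\in\widetilde S_n}\lvert D_R(\widetilde{\mathtt s}(w))\rvert=\left\lfloor\frac n2\right\rfloor,$$ where $\widetilde{\mathtt s}:\widetilde S_n\to\widetilde S_n$ is the affine stack-sorting map.
   Context: An affine permutation of size $n$ is a bijection $w:\mathbb Z\to\mathbb Z$ with $w(i+n)=w(i)+n$ for all $i\in\mathbb Z$ and $\sum_{i=1}^n w(i)=\binom{n+1}{2}$. They form the affine symmetric group $\widetilde S_n$ under composition (trivial if $n=1$), a Coxeter group with simple generators $\widetilde s_1,\ldots,\widetilde s_n$, where $\widetilde s_i$ swaps $i+mn$ and $i+mn+1$ for all $m\in\mathbb Z$ and fixes all other integers. The right descent set is $D_R(w)=\{\widetilde s_i:1\le i\le n,\ w(i)>w(i+1)\}$. The left weak order is $x\leq_L y\iff\ell(yx^{-1})=\ell(y)-\ell(x)$, $\ell$ being Coxeter length. Affine sylvester congruence. For $w\in\widetilde S_n$ define a partial order $\preceq_w$ on $\mathbb Z$ (positions): for $i<j$, the positions $i,j$ are incomparable if and only if there is $k$ with $i<k<j$ and $w(k)>\max\{w(i),w(j)\}$; otherwise the position with the smaller value of $w$ is below the other. (This is the descendant order of the decreasing affine binary plane tree with in-order reading $w$.) The affine sylvester congruence is $v\equiv_{\widetilde{\mathrm{syl}}}w\iff{\preceq_v}={\preceq_w}$; it is a semilattice congruence on $(\widetilde S_n,\leq_L)$ in which $\{e\}$ is a class, and each class has a unique $\leq_L$-minimal element. Let $\pi_\downarrow(w)$ be the minimal element of the class of $w$. The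 affine stack-sorting map is $\widetilde{\mathtt s}(w)=w\,(\pi_\downarrow(w))^{-1}$. *)

theory Defs
  imports Complex_Main
begin

definition affine_perms :: "nat \<Rightarrow> (int \<Rightarrow> int) set" where
  "affine_perms n =
     {w. bij w \<and> (\<forall>i. w (i + int n) = w i + int n) \<and>
         (\<Sum>i\<in>{1..int n}. w i) = int ((n + 1) choose 2)}"

text \<open>
  The following is the simple reflection only for \<open>n \<ge> 2\<close>. For \<open>n = 1\<close> it is a translation
  lying outside the (trivial) group; this is harmless below, because then the only
  group element is the identity, whose length is \<open>0\<close> and whose descent set is empty.
\<close>

definition affine_simple :: "nat \<Rightarrow> int \<Rightarrow> int \<Rightarrow> int" where
  "affine_simple n i =
     (\<lambda>j. if j mod int n = i mod int n then j + 1
          else if j mod int n = (i + 1) mod int n then j - 1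
          else j)"

definition affine_generators :: "nat \<Rightarrow> (int \<Rightarrow> int) set" where
  "affine_generators n = affine_simple n ` {1..int n}"

definition affine_length :: "nat \<Rightarrow> (int \<Rightarrow> int) \<Rightarrow> nat" where
  "affine_length n w =
     (LEAST k. \<exists>ws. set ws \<subseteq> affine_generators n \<and> length ws = k \<and> foldr (\<circ>) ws id = w)"

definition right_descents :: "nat \<Rightarrow> (int \<Rightarrow> int) \<Rightarrow> (int \<Rightarrow> int) set" where
  "right_descents n w = {affine_simple n i | i. 1 \<le> i \<and> i \<le> int n \<and> w i > w (i + 1)}"

text \<open>The difference of lengths is taken in \<^typ>\<open>int\<close>, so it is not truncated.\<close>

definition left_weak_le :: "nat \<Rightarrow> (int \<Rightarrow> int) \<Rightarrow> (int \<Rightarrow> int) \<Rightarrow> bool" where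
  "left_weak_le n x y \<longleftrightarrow>
     int (affine_length n (y \<circ> inv x)) = int (affine_length n y) - int (affine_length n x)"

definition pos_incomparable :: "(int \<Rightarrow> int) \<Rightarrow> int \<Rightarrow> int \<Rightarrow> bool" where
  "pos_incomparable w i j \<longleftrightarrow>
     (\<exists>k. min i j < k \<and> k < max i j \<and> w k > max (w i) (w j))"

definition pos_le :: "(int \<Rightarrow> int) \<Rightarrow> int \<Rightarrow> int \<Rightarrow> bool" where
  "pos_le w i j \<longleftrightarrow> i = j \<or> (\<not> pos_incomparable w i j \<and> w i < w j)"

definition affine_sylvester :: "nat \<Rightarrow> ((int \<Rightarrow> int) \<times> (int \<Rightarrow> int)) set" where
  "affine_sylvester n =
     {(v, w). v \<in> affine_perms n \<and> w \<in> affine_perms n \<and> pos_le v = pos_le w}"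

definition pi_down :: "nat \<Rightarrow> (int \<Rightarrow> int) \<Rightarrow> int \<Rightarrow> int" where
  "pi_down n w =
     (THE u. u \<in> affine_sylvester n `` {w} \<and>
             (\<forall>v \<in> affine_sylvester n `` {w}. left_weak_le n v u \<longrightarrow> v = u))"

definition affine_stack_sort :: "nat \<Rightarrow> (int \<Rightarrow> int) \<Rightarrow> int \<Rightarrow> int" where
  "affine_stack_sort n w = w \<circ> inv (pi_down n w)"

end

(* The minimal element of the class of w is u, where u(i) is the rank of position i in the
   postorder traversal of the tree of w: for i < j it inverts (i, j) iff w(i) is the maximum of
   w on [i, j], and since Coxeter length counts inversions up to translation, u lies below the
   whole class. So w u^-1 lists the values of w in postorder. If it has a descent at a, the
   position visited at time a + 1 is a leaf of the tree, i.e. a local minimum of w, and at most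
   n div 2 of n cyclically consecutive positions are local minima. Equality holds for a zigzag with
   n div 2 deep valleys per period and increasing values at all other positions. *)
theory Submission imports Defs begin

text \<open>The tree has no root and its postorder no first position, so ranks cannot be counted
  from a start. They are read off from inversions: a normalised affine permutation satisfies u(i) =
  i + #{j > i : u(j) < u(i)} - #{j < i : u(j) > u(i)}, and for postorder the two sets are the right
  subtree of i and the positions whose right subtree contains i. Both are finite by periodicity.

  \<open>pi_down\<close> is a definite description in an order defined through shortest words.
  Exhibiting a least element of the class settles existence and uniqueness together. This rests on
  one half of the inversion criterion: inclusion of inversion sets yields a reduced word leading
  from the smaller to the larger permutation.

  The passage from descents to valleys has no converse, since the value read just before a valley
  may be smaller (as in 1324, repeated periodically). This is why the extremal example needs deep
  valleys.\<close>

section \<open>Periodic bijections of the integers\<close>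

text \<open>The sum condition is left out so that translations, which reindex sums and shift
  postorder times below, are covered.\<close>

definition periodic_bij :: "nat \<Rightarrow> (int \<Rightarrow> int) \<Rightarrow> bool" where
  "periodic_bij n w \<longleftrightarrow> bij w \<and> (\<forall>i. w (i + int n) = w i + int n)"

lemma shift_mult:
  assumes "\<And>i. w (i + int n) = w i + (c::int)"
  shows "w (i + int n * m) = w i + c * m"
proof (induction m rule: int_induct[where k = 0])
  case (step1 m)
  have "w (i + int n * (m + 1)) = w ((i + int n * m) + int n)" by (simp add: algebra_simps)
  then show ?case using step1 by (simp only: assms) (simp add: algebra_simps)
next
  case (step2 m)
  have "w (i + int n * m) = w ((i + int n * (m - 1)) + int n)" by (simp add: algebra_simps)
  then show ?case using step2 by (simp only: assms) (simp add: algebra_simps)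
qed simp

lemma periodic_bij_shift:
  assumes "periodic_bij n w"
  shows "w (i + int n * m) = w i + int n * m"
  using assms shift_mult[of w n "int n"] by (simp add: periodic_bij_def)

lemma periodic_bij_eq_iff:
  assumes "periodic_bij n w"
  shows "w i = w j \<longleftrightarrow> i = j"
  using assms by (auto simp: periodic_bij_def bij_def inj_def)

lemma periodic_bij_inv:
  assumes "periodic_bij n w"
  shows "periodic_bij n (inv w)"
proof -
  have b: "bij w" using assms by (simp add: periodic_bij_def)
  have "inv w (i + int n) = inv w i + int n" for i
  proof -
    have "w (inv w i + int n) = i + int n"
      using assms b by (simp add: periodic_bij_def surj_f_inv_f bij_is_surj)
    then show ?thesis using b by (metis bij_inv_eq_iff)
  qed
  then show ?thesis using b by (simp add: periodic_bij_def bij_imp_bij_inv)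
qed

lemma periodic_bij_inv_eq:
  assumes "periodic_bij n w"
  shows "w (inv w i) = i" "inv w (w i) = i"
  using assms by (auto simp: periodic_bij_def surj_f_inv_f bij_is_surj inv_f_f bij_is_inj)

lemma periodic_bij_comp:
  assumes "periodic_bij n v" "periodic_bij n w"
  shows "periodic_bij n (v \<circ> w)"
  using assms by (auto simp: periodic_bij_def intro: bij_comp)

lemma mod_eq_obtain:
  assumes "(a::int) mod int n = b mod int n"
  obtains m where "a = b + int n * m"
proof -
  have "int n dvd a - b" using assms by (simp add: mod_eq_dvd_iff)
  then obtain m where "a - b = int n * m" by (rule dvdE)
  then show ?thesis using that[of m] by (simp add: algebra_simps)
qed

lemma interval_representative:
  assumes "n \<ge> 1"
  obtains m where "i + int n * m \<in> {1..int n}"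
proof -
  have "i + int n * (- ((i - 1) div int n)) = (i - 1) mod int n + 1"
    by (simp add: minus_div_mult_eq_mod[symmetric] algebra_simps)
  moreover have "(i - 1) mod int n \<ge> 0" "(i - 1) mod int n < int n"
    using assms by auto
  ultimately have "i + int n * (- ((i - 1) div int n)) \<in> {1..int n}" by simp
  then show ?thesis using that by blast
qed

lemma interval_shift_unique:
  assumes "i \<in> {1..int n}" "i + int n * m \<in> {1..int n}"
  shows "m = 0"
proof -
  have "int n * m < int n * 1" "int n * (- 1) < int n * m"
    using assms unfolding atLeastAtMost_iff by linarith+
  then have "m < 1" "- 1 < m" using mult_less_cancel_left_pos[of "int n"] assms by fastforce+
  then show ?thesis by simp
qed

text \<open>Congruent images differ by a multiple of n, hence so do their positions, which coincide
  inside one window. An injection of a finite set into itself is onto.\<close>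

lemma bij_betw_residues:
  assumes inj: "inj w" and shift: "\<And>i. w (i + int n) = w i + int n" and n: "n \<ge> 1"
  shows "bij_betw (\<lambda>i. (w i - 1) mod int n + 1) {1..int n} {1..int n}"
proof -
  let ?g = "\<lambda>i. (w i - 1) mod int n + 1"
  have sub: "?g ` {1..int n} \<subseteq> {1..int n}"
    using n by (auto simp: add1_zle_eq)
  have "inj_on ?g {1..int n}"
  proof (rule inj_onI)
    fix i j assume i: "i \<in> {1..int n}" and j: "j \<in> {1..int n}" and "?g i = ?g j"
    then have "w i mod int n = w j mod int n" by (simp add: mod_eq_dvd_iff)
    then obtain m where m: "w i = w j + int n * m" by (rule mod_eq_obtain)
    then have "w i = w (j + int n * m)" using shift_mult[of w n "int n" j m] shift by simp
    then have "i = j + int n * m" using inj by (simp add: inj_eq)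
    with interval_shift_unique i j show "i = j" by simp
  qed
  then show ?thesis using sub by (simp add: bij_betw_def endo_inj_surj)
qed

lemma sum_periodic_reindex:
  fixes f :: "int \<Rightarrow> 'a::comm_monoid_add"
  assumes w: "periodic_bij n w" and n: "n \<ge> 1" and f: "\<And>i. f (i + int n) = f i"
  shows "(\<Sum>i\<in>{1..int n}. f (w i)) = (\<Sum>i\<in>{1..int n}. f i)"
proof -
  have f': "f (i + int n * m) = f i" for i m
  proof (induction m rule: int_induct[where k = 0])
    case (step1 m)
    have "f (i + int n * (m + 1)) = f ((i + int n * m) + int n)" by (simp add: algebra_simps)
    then show ?case using step1 f by simp
  next
    case (step2 m)
    have "f (i + int n * m) = f ((i + int n * (m - 1)) + int n)" by (simp add: algebra_simps)
    then show ?case using step2 f by simp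
  qed simp
  define g where "g i = (w i - 1) mod int n + 1" for i
  have g: "g i = w i + int n * (- ((w i - 1) div int n))" for i
    by (simp add: g_def minus_div_mult_eq_mod[symmetric] algebra_simps)
  have "bij_betw g {1..int n} {1..int n}"
    unfolding g_def by (rule bij_betw_residues) (use w n in \<open>auto simp: periodic_bij_def bij_def\<close>)
  moreover have "f (g i) = f (w i)" for i by (simp only: g f')
  ultimately show ?thesis using sum.reindex_bij_betw[of g "{1..int n}" "{1..int n}" f] by simp
qed

lemma periodic_bij_if_inj:
  assumes inj: "inj w" and shift: "\<And>i. w (i + int n) = w i + int n" and n: "n \<ge> 1"
  shows "periodic_bij n w"
proof -
  have "y \<in> range w" for y
  proof -
    obtain m where "y + int n * m \<in> {1..int n}" using interval_representative[OF n] .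
    then obtain i where i: "y + int n * m = (w i - 1) mod int n + 1"
      using bij_betw_imp_surj_on[OF bij_betw_residues[OF assms]] by blast
    have "y = w i + int n * (- ((w i - 1) div int n) - m)"
      using i by (simp add: minus_div_mult_eq_mod[symmetric] algebra_simps)
    also have "\<dots> = w (i + int n * (- ((w i - 1) div int n) - m))"
      using shift_mult[of w n "int n"] shift by simp
    finally show ?thesis by blast
  qed
  then have "surj w" by blast
  then show ?thesis using inj shift by (simp add: periodic_bij_def bij_def)
qed

text \<open>\<open>w i - i\<close> depends only on the residue of \<open>i\<close>. This is what
  bounds the distance between the two positions of an inversion.\<close>

lemma displacement_bounded:
  assumes w: "periodic_bij n w" and n: "n \<ge> 1"
  obtains C where "\<And>i. \<bar>w i - i\<bar> \<le> C"
proof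
  fix i
  let ?C = "Max ((\<lambda>r. \<bar>w r - r\<bar>) ` {1..int n})"
  obtain m where m: "i + int n * m \<in> {1..int n}" using interval_representative[OF n] .
  have "\<bar>w i - i\<bar> = \<bar>w (i + int n * m) - (i + int n * m)\<bar>"
    by (simp add: periodic_bij_shift[OF w])
  also have "\<dots> \<le> ?C" using m by (intro Max_ge) auto
  finally show "\<bar>w i - i\<bar> \<le> ?C" .
qed

section \<open>Length and inversions\<close>

definition inversions :: "(int \<Rightarrow> int) \<Rightarrow> (int \<times> int) set" where
  "inversions w = {(i, j). i < j \<and> w j < w i}"

text \<open>Inversions come in orbits under simultaneous translation by n; a first entry in
  \<open>{1..int n}\<close> selects one pair per orbit. On the group this is the Coxeter length when
  \<open>n \<ge> 2\<close>.\<close>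

definition ninv :: "nat \<Rightarrow> (int \<Rightarrow> int) \<Rightarrow> nat" where
  "ninv n w = card (inversions w \<inter> {1..int n} \<times> UNIV)"

lemma inversions_shift:
  assumes "periodic_bij n w"
  shows "(i + int n * m, j + int n * m) \<in> inversions w \<longleftrightarrow> (i, j) \<in> inversions w"
  by (simp add: inversions_def periodic_bij_shift[OF assms])

lemma finite_inversions:
  assumes w: "periodic_bij n w" and n: "n \<ge> 1"
  shows "finite (inversions w \<inter> {1..int n} \<times> UNIV)"
proof -
  obtain C where C: "\<And>i. \<bar>w i - i\<bar> \<le> C" using displacement_bounded[OF w n] by blast
  have "inversions w \<inter> {1..int n} \<times> UNIV \<subseteq> {1..int n} \<times> {1..int n + 2 * C}"
  proof
    fix x assume x: "x \<in> inversions w \<inter> {1..int n} \<times> UNIV"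
    obtain i j where "x = (i, j)" by fastforce
    then show "x \<in> {1..int n} \<times> {1..int n + 2 * C}"
      using x C[of i] C[of j] by (auto simp: inversions_def)
  qed
  then show ?thesis by (rule finite_subset) simp
qed

lemma ninv_id: "ninv n id = 0"
proof -
  have "inversions id = {}" by (auto simp: inversions_def)
  then show ?thesis by (simp add: ninv_def)
qed

lemma mod_add_one_neq:
  assumes "n \<ge> 2"
  shows "(a + 1) mod int n \<noteq> a mod int n"
  using assms by (auto simp: mod_eq_dvd_iff)

lemma mod_add_one_iff:
  "(a + 1) mod int n = (k + 1) mod int n \<longleftrightarrow> a mod int n = k mod int n"
  by (simp add: mod_eq_dvd_iff)

lemma affine_simple_involution:
  assumes "n \<ge> 2"
  shows "affine_simple n k (affine_simple n k j) = j"
proof -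
  have "(j - 1) mod int n = k mod int n" if "j mod int n = (k + 1) mod int n"
    using that mod_add_one_iff[of "j - 1" n k] by simp
  moreover have "(j + 1) mod int n = (k + 1) mod int n \<and> (j + 1) mod int n \<noteq> k mod int n"
    if "j mod int n = k mod int n"
    using that mod_add_one_iff[of j n k] mod_add_one_neq[OF assms, of j] by simp
  ultimately show ?thesis by (auto simp: affine_simple_def)
qed

lemma affine_simple_comp_self:
  assumes "n \<ge> 2"
  shows "affine_simple n k \<circ> (affine_simple n k \<circ> w) = w"
  using affine_simple_involution[OF assms] by (simp add: fun_eq_iff)

text \<open>\<open>affine_simple n k\<close> moves a point by at most 1, which leaves distances 1
  and 2 to check. At distance 2 the images could only meet if x and x + 1 were congruent mod n,
  excluded by \<open>n \<ge> 2\<close>.\<close>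

lemma affine_simple_less_iff:
  assumes n: "n \<ge> 2"
  shows "affine_simple n k b < affine_simple n k a \<longleftrightarrow>
    (b < a \<and> \<not> (a = b + 1 \<and> b mod int n = k mod int n)) \<or>
    (b = a + 1 \<and> a mod int n = k mod int n)"
proof -
  let ?s = "affine_simple n k"
  have less: "?s x < ?s y" if "x < y" "\<not> (y = x + 1 \<and> x mod int n = k mod int n)" for x y
  proof -
    consider "y = x + 1" | "y = x + 2" | "y \<ge> x + 3" using \<open>x < y\<close> by linarith
    then show ?thesis
    proof cases
      case 1
      then show ?thesis using that mod_add_one_iff[of x n k] by (auto simp: affine_simple_def)
    next
      case 2
      have "\<not> (x mod int n = k mod int n \<and> (x + 2) mod int n = (k + 1) mod int n)"
        using mod_add_one_iff[of "x + 1" n k] mod_add_one_neq[OF n, of x] by (auto simp: add.commute)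
      then show ?thesis using 2 by (auto simp: affine_simple_def)
    next
      case 3
      have "?s x \<le> x + 1" "?s y \<ge> y - 1" by (auto simp: affine_simple_def)
      then show ?thesis using 3 by linarith
    qed
  qed
  have swap: "?s (x + 1) < ?s x" if "x mod int n = k mod int n" for x
    using that mod_add_one_iff[of x n k] mod_add_one_neq[OF n, of x]
    by (auto simp: affine_simple_def)
  consider "a = b" | "b < a" | "a < b" by linarith
  then show ?thesis
  proof cases
    case 2
    then show ?thesis using less[of b a] swap[of b] by auto
  next
    case 3
    then show ?thesis
      using less[of a b] swap[of a] by (cases "b = a + 1 \<and> a mod int n = k mod int n") auto
  qed simp
qed

lemma periodic_bij_affine_simple:
  assumes "n \<ge> 2"
  shows "periodic_bij n (affine_simple n k)"
proof -
  have "bij (affine_simple n k)"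
    by (rule involuntory_imp_bij) (rule affine_simple_involution[OF assms])
  then show ?thesis by (simp add: periodic_bij_def affine_simple_def)
qed

lemma affine_perms_iff:
  "w \<in> affine_perms n \<longleftrightarrow> periodic_bij n w \<and> (\<Sum>i\<in>{1..int n}. w i) = int ((n + 1) choose 2)"
  by (auto simp: affine_perms_def periodic_bij_def)

lemma affine_simple_comp_affine_perms:
  assumes w: "w \<in> affine_perms n" and n: "n \<ge> 2"
  shows "affine_simple n k \<circ> w \<in> affine_perms n"
proof -
  let ?s = "affine_simple n k"
  let ?d = "\<lambda>i. ?s i - i"
  have pw: "periodic_bij n w" using w by (simp add: affine_perms_iff)
  have ps: "periodic_bij n ?s" by (rule periodic_bij_affine_simple[OF n])
  \<comment> \<open>The displacement of an involution changes sign under it, while reindexing by it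
    preserves the sum over a period.\<close>
  have "(\<Sum>i\<in>{1..int n}. ?d i) = (\<Sum>i\<in>{1..int n}. ?d (?s i))"
    using sum_periodic_reindex[OF ps, of ?d] n ps by (simp add: periodic_bij_def)
  also have "\<dots> = (\<Sum>i\<in>{1..int n}. - ?d i)"
    by (simp add: affine_simple_involution[OF n])
  also have "\<dots> = - (\<Sum>i\<in>{1..int n}. ?d i)" by (rule sum_negf)
  finally have "(\<Sum>i\<in>{1..int n}. ?d i) = 0" by linarith
  then have "(\<Sum>i\<in>{1..int n}. ?d (w i)) = 0"
    using sum_periodic_reindex[OF pw, of ?d] n ps by (simp add: periodic_bij_def)
  then have "(\<Sum>i\<in>{1..int n}. (?s \<circ> w) i) = (\<Sum>i\<in>{1..int n}. w i)"
    by (simp add: sum_subtractf)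
  then show ?thesis using w periodic_bij_comp[OF ps pw] by (simp add: affine_perms_iff)
qed

text \<open>The swap affects only the pairs of positions that carry the swapped values, and these
  form one orbit under translation: inversions before the swap, none after it.\<close>

lemma ninv_affine_simple_comp:
  assumes w: "periodic_bij n w" and n: "n \<ge> 2"
    and qp: "q < p" "w q = w p + 1" "w p mod int n = k mod int n"
  shows "ninv n w = Suc (ninv n (affine_simple n k \<circ> w))"
proof -
  let ?s = "affine_simple n k"
  have n1: "n \<ge> 1" using n by simp
  have mem: "(i, j) \<in> inversions (?s \<circ> w) \<longleftrightarrow>
      (i, j) \<in> inversions w \<and> \<not> (w i = w j + 1 \<and> w j mod int n = k mod int n)
      \<or> i < j \<and> w j = w i + 1 \<and> w i mod int n = k mod int n" for i j
    unfolding inversions_def by (auto simp: affine_simple_less_iff[OF n])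
  obtain c where c: "q + int n * c \<in> {1..int n}" using interval_representative[OF n1] .
  define q0 p0 where "q0 = q + int n * c" and "p0 = p + int n * c"
  have q0: "q0 \<in> {1..int n}" "q0 < p0" "w q0 = w p0 + 1" "w p0 mod int n = k mod int n"
    using c qp by (auto simp: q0_def p0_def periodic_bij_shift[OF w])
  have tr: "\<exists>m. i = q0 + int n * m \<and> j = p0 + int n * m"
    if ij: "w i = w j + 1" "w j mod int n = k mod int n" for i j
  proof -
    obtain m where m: "w j = w p0 + int n * m"
      using ij(2) q0(4) mod_eq_obtain[of "w j" n "w p0"] by auto
    then have "w j = w (p0 + int n * m)" "w i = w (q0 + int n * m)"
      using ij(1) q0(3) by (simp_all add: periodic_bij_shift[OF w])
    then show ?thesis using periodic_bij_eq_iff[OF w] by blast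
  qed
  have "inversions w \<inter> {1..int n} \<times> UNIV =
      insert (q0, p0) (inversions (?s \<circ> w) \<inter> {1..int n} \<times> UNIV)" (is "?A = insert _ ?B")
  proof (intro equalityI subsetI)
    fix x assume x: "x \<in> ?A"
    obtain i j where ij: "x = (i, j)" by fastforce
    show "x \<in> insert (q0, p0) ?B"
    proof (cases "w i = w j + 1 \<and> w j mod int n = k mod int n")
      case True
      then obtain m where m: "i = q0 + int n * m" "j = p0 + int n * m" using tr by blast
      then have "m = 0" using x ij q0(1) interval_shift_unique[of q0 n m] by simp
      then show ?thesis using m ij by simp
    next
      case False
      then show ?thesis using x ij mem[of i j] by blast
    qed
  next
    fix x assume x: "x \<in> insert (q0, p0) ?B"
    obtain i j where ij: "x = (i, j)" by fastforce
    \<comment> \<open>A new inversion would be a translate of \<open>(q0, p0)\<close> read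
      backwards, against \<open>q0 < p0\<close>.\<close>
    have no: "\<not> (i < j \<and> w j = w i + 1 \<and> w i mod int n = k mod int n)"
      using tr[of j i] q0(2) by force
    show "x \<in> ?A"
    proof (cases "x = (q0, p0)")
      case True
      then show ?thesis using q0 by (simp add: inversions_def)
    next
      case False
      then show ?thesis using x ij no mem[of i j] by blast
    qed
  qed
  moreover have "(q0, p0) \<notin> inversions (?s \<circ> w)" using mem[of q0 p0] q0(3,4) by simp
  moreover have "finite ?B"
    by (rule finite_inversions[OF periodic_bij_comp[OF periodic_bij_affine_simple[OF n] w] n1])
  ultimately show ?thesis by (simp add: ninv_def)
qed

lemma ninv_affine_simple_comp_le:
  assumes w: "periodic_bij n w" and n: "n \<ge> 2"
  shows "ninv n (affine_simple n k \<circ> w) \<le> Suc (ninv n w)"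
proof -
  let ?s = "affine_simple n k"
  define p q where "p = inv w k" and "q = inv w (k + 1)"
  have pq: "w p = k" "w q = k + 1" by (simp_all add: p_def q_def periodic_bij_inv_eq[OF w])
  then have "p \<noteq> q" by auto
  then consider "q < p" | "p < q" by linarith
  then show ?thesis
  proof cases
    case 1
    then show ?thesis using ninv_affine_simple_comp[OF w n, of q p k] pq by simp
  next
    case 2
    \<comment> \<open>In this order of \<open>p\<close> and \<open>q\<close> the swap creates the
      inversion: the previous lemma applies to \<open>?s \<circ> w\<close>, and swapping again gives
      back \<open>w\<close>.\<close>
    have "?s k = k + 1" "?s (k + 1) = k"
      using mod_add_one_neq[OF n, of k] by (auto simp: affine_simple_def)
    then show ?thesis
      using ninv_affine_simple_comp[OF periodic_bij_comp[OF periodic_bij_affine_simple[OF n] w] n,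
          of p q k k] pq 2
      by (simp add: affine_simple_comp_self[OF n])
  qed
qed

lemma ninv_word_le:
  assumes x: "periodic_bij n x" and n: "n \<ge> 2" and ws: "set ws \<subseteq> affine_generators n"
  shows "ninv n (foldr (\<circ>) ws id \<circ> x) \<le> length ws + ninv n x"
proof -
  have "periodic_bij n (foldr (\<circ>) ws id \<circ> x) \<and>
    ninv n (foldr (\<circ>) ws id \<circ> x) \<le> length ws + ninv n x"
    using ws
  proof (induction ws)
    case (Cons s ws)
    then obtain k where k: "s = affine_simple n k" by (auto simp: affine_generators_def)
    have "set ws \<subseteq> affine_generators n" using Cons.prems by simp
    then have IH: "periodic_bij n (foldr (\<circ>) ws id \<circ> x)"
      "ninv n (foldr (\<circ>) ws id \<circ> x) \<le> length ws + ninv n x" using Cons.IH by blast+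
    have eq: "foldr (\<circ>) (s # ws) id \<circ> x = affine_simple n k \<circ> (foldr (\<circ>) ws id \<circ> x)"
      by (simp add: k fun_eq_iff)
    have "ninv n (affine_simple n k \<circ> (foldr (\<circ>) ws id \<circ> x)) \<le> length (s # ws) + ninv n x"
      using ninv_affine_simple_comp_le[OF IH(1) n, of k] IH(2) by simp
    then show ?case
      using periodic_bij_comp[OF periodic_bij_affine_simple[OF n] IH(1), of k]
      by (simp only: eq)
  qed (use x in simp)
  then show ?thesis by simp
qed

lemma affine_simple_in_generators:
  assumes "n \<ge> 1"
  shows "affine_simple n k \<in> affine_generators n"
proof -
  obtain m where m: "k + int n * m \<in> {1..int n}" using interval_representative[OF assms] .
  have "(k + int n * m + 1) mod int n = (k + 1) mod int n"
    using mod_mult_self2[of "k + 1" "int n" m] by (simp add: algebra_simps)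
  then have "affine_simple n k = affine_simple n (k + int n * m)"
    by (simp add: affine_simple_def fun_eq_iff)
  then show ?thesis using m by (auto simp: affine_generators_def)
qed

text \<open>\<open>u \<circ> inv v\<close> is an increasing bijection of the integers, hence a
  translation, and equal sums over a window make it trivial. Contrapositively, distinct
  \<open>u\<close> and \<open>v\<close> disagree on the order of some adjacent values of
  \<open>v\<close>, which drives the induction below.\<close>

lemma affine_perms_eq_if_order_eq:
  assumes u: "u \<in> affine_perms n" and v: "v \<in> affine_perms n" and n: "n \<ge> 1"
    and less: "\<And>x. u (inv v x) < u (inv v (x + 1))"
  shows "u = v"
proof -
  have pu: "periodic_bij n u" and pv: "periodic_bij n v" using u v by (auto simp: affine_perms_iff)
  define g where "g = u \<circ> inv v"
  have pg: "periodic_bij n g"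
    unfolding g_def by (rule periodic_bij_comp[OF pu periodic_bij_inv[OF pv]])
  have gl: "g x < g y" if "x < y" for x y
    using that
  proof (induction y rule: int_gr_induct)
    case base
    then show ?case using less by (simp add: g_def)
  next
    case (step i)
    then show ?case using less[of i] by (simp add: g_def)
  qed
  have step: "g (x + 1) = g x + 1" for x
  proof -
    define y where "y = inv g (g x + 1)"
    have y: "g y = g x + 1" by (simp add: y_def periodic_bij_inv_eq[OF pg])
    have "x < y" using gl[of y x] y by (cases "x = y") force+
    moreover have "\<not> x + 1 < y" using gl[of "x + 1" y] gl[of x "x + 1"] y by auto
    ultimately have "y = x + 1" by simp
    then show ?thesis using y by simp
  qed
  have g: "g x = x + g 0" for x
    using shift_mult[of g 1 1 0 x] step by simp
  have uv: "u i = v i + g 0" for i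
    using g[of "v i"] by (simp add: g_def periodic_bij_inv_eq[OF pv])
  have "(\<Sum>i\<in>{1..int n}. u i) = (\<Sum>i\<in>{1..int n}. v i) + int n * g 0"
    by (simp add: uv sum.distrib)
  then have "g 0 = 0" using u v n by (simp add: affine_perms_iff)
  then show ?thesis using uv by auto
qed

text \<open>If \<open>u\<close> differs from \<open>v\<close>, then \<open>u q < u p\<close> for the
  positions \<open>p\<close>, \<open>q\<close> of some adjacent values \<open>x\<close>,
  \<open>x + 1\<close> of \<open>v\<close>. Inclusion of inversions forces \<open>q < p\<close>, so
  swapping the two values in \<open>v\<close> removes only an orbit of inversions that
  \<open>u\<close> lacks, and the induction continues.\<close>

lemma inversions_subset_word:
  assumes u: "u \<in> affine_perms n" and n: "n \<ge> 2"
    and "v \<in> affine_perms n" "inversions u \<subseteq> inversions v"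
  shows "\<exists>ws. set ws \<subseteq> affine_generators n \<and> ninv n v = length ws + ninv n u \<and>
    v = foldr (\<circ>) ws id \<circ> u"
  using assms(3,4)
proof (induction "ninv n v" arbitrary: v rule: less_induct)
  case less
  have pu: "periodic_bij n u" and pv: "periodic_bij n v"
    using u less.prems by (auto simp: affine_perms_iff)
  show ?case
  proof (cases "u = v")
    case True
    then show ?thesis by (intro exI[of _ "[]"]) simp
  next
    case False
    then obtain x where x: "\<not> u (inv v x) < u (inv v (x + 1))"
      using affine_perms_eq_if_order_eq[OF u less.prems(1)] n by fastforce
    define p q where "p = inv v x" and "q = inv v (x + 1)"
    have vpq: "v p = x" "v q = x + 1"
      by (simp_all add: p_def q_def periodic_bij_inv_eq[OF pv])
    then have "p \<noteq> q" by auto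
    then have upq: "u q < u p"
      using x periodic_bij_eq_iff[OF pu, of p q] by (simp add: p_def q_def)
    have qp: "q < p"
    proof (rule ccontr)
      assume "\<not> q < p"
      then have "(p, q) \<in> inversions u" using upq \<open>p \<noteq> q\<close> by (simp add: inversions_def)
      then show False using less.prems(2) vpq by (auto simp: inversions_def)
    qed
    let ?s = "affine_simple n x"
    have sv: "?s \<circ> v \<in> affine_perms n"
      by (rule affine_simple_comp_affine_perms[OF less.prems(1) n])
    have nv: "ninv n v = Suc (ninv n (?s \<circ> v))"
      by (rule ninv_affine_simple_comp[OF pv n qp]) (simp_all add: vpq)
    have "inversions u \<subseteq> inversions (?s \<circ> v)"
    proof clarify
      fix i j assume ij: "(i, j) \<in> inversions u"
      have "\<not> (v i = v j + 1 \<and> v j mod int n = x mod int n)"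
      proof
        assume *: "v i = v j + 1 \<and> v j mod int n = x mod int n"
        then obtain m where m: "v j = x + int n * m" using mod_eq_obtain by blast
        then have "v j = v (p + int n * m)" "v i = v (q + int n * m)"
          using * vpq by (simp_all add: periodic_bij_shift[OF pv])
        then have "j = p + int n * m" "i = q + int n * m"
          using periodic_bij_eq_iff[OF pv] by blast+
        then have "(q, p) \<in> inversions u" using ij inversions_shift[OF pu] by simp
        then show False using upq by (simp add: inversions_def)
      qed
      moreover have "(i, j) \<in> inversions v" using ij less.prems(2) by blast
      ultimately show "(i, j) \<in> inversions (?s \<circ> v)"
        by (auto simp: inversions_def affine_simple_less_iff[OF n])
    qed
    then obtain ws where ws: "set ws \<subseteq> affine_generators n"
      "ninv n (?s \<circ> v) = length ws + ninv n u" "?s \<circ> v = foldr (\<circ>) ws id \<circ> u"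
      using less.hyps[OF _ sv] nv by auto
    have "v = ?s \<circ> (foldr (\<circ>) ws id \<circ> u)"
      using affine_simple_comp_self[OF n, of x v] ws(3) by simp
    then show ?thesis
      using ws(1,2) nv affine_simple_in_generators[of n x] n
      by (intro exI[of _ "?s # ws"]) (simp add: comp_assoc)
  qed
qed

text \<open>The word just built has length \<open>ninv n v - ninv n u\<close>, and a shorter one
  could not create that many inversions, each generator adding at most one.\<close>

lemma affine_length_comp_inv:
  assumes u: "u \<in> affine_perms n" and v: "v \<in> affine_perms n" and n: "n \<ge> 2"
    and sub: "inversions u \<subseteq> inversions v"
  shows "affine_length n (v \<circ> inv u) + ninv n u = ninv n v"
proof -
  have pu: "periodic_bij n u" using u by (simp add: affine_perms_iff)
  have inv: "u \<circ> inv u = id" "inv u \<circ> u = id"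
    by (simp_all add: fun_eq_iff periodic_bij_inv_eq[OF pu])
  obtain ws where ws: "set ws \<subseteq> affine_generators n"
      "ninv n v = length ws + ninv n u" "v = foldr (\<circ>) ws id \<circ> u"
    using inversions_subset_word[OF u n v sub] by blast
  have "affine_length n (v \<circ> inv u) = length ws"
    unfolding affine_length_def
  proof (rule Least_equality)
    show "\<exists>ws'. set ws' \<subseteq> affine_generators n \<and> length ws' = length ws \<and>
        foldr (\<circ>) ws' id = v \<circ> inv u"
      using ws inv by (intro exI[of _ ws]) (simp add: comp_assoc)
  next
    fix l assume "\<exists>ws'. set ws' \<subseteq> affine_generators n \<and> length ws' = l \<and>
        foldr (\<circ>) ws' id = v \<circ> inv u"
    then obtain ws' where ws': "set ws' \<subseteq> affine_generators n" "length ws' = l"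
      "foldr (\<circ>) ws' id = v \<circ> inv u" by blast
    then have "foldr (\<circ>) ws' id \<circ> u = v" using inv by (simp add: comp_assoc)
    then show "length ws \<le> l" using ninv_word_le[OF pu n ws'(1)] ws' ws(2) by simp
  qed
  then show ?thesis using ws(2) by simp
qed

lemma id_affine_perms: "id \<in> affine_perms n"
proof -
  have "(\<Sum>i\<in>{1..int n}. i) = int ((n + 1) choose 2)"
  proof (induction n)
    case (Suc n)
    have "{1..int (Suc n)} = insert (int (Suc n)) {1..int n}" by auto
    then show ?case using Suc by (simp add: numeral_2_eq_2)
  qed simp
  then show ?thesis by (simp add: affine_perms_def)
qed

lemma affine_length_eq_ninv:
  assumes "v \<in> affine_perms n" "n \<ge> 2"
  shows "affine_length n v = ninv n v"
proof -
  have "inversions id \<subseteq> inversions v" by (auto simp: inversions_def)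
  from affine_length_comp_inv[OF id_affine_perms assms this] show ?thesis by (simp add: ninv_id)
qed

section \<open>The minimal element of a sylvester class\<close>

text \<open>In the decreasing tree of \<open>w\<close>, \<open>j\<close> lies in the right subtree
  of \<open>i\<close>.\<close>

definition dominates :: "(int \<Rightarrow> int) \<Rightarrow> int \<Rightarrow> int \<Rightarrow> bool" where
  "dominates w i j \<longleftrightarrow> i < j \<and> (\<forall>k. i < k \<and> k \<le> j \<longrightarrow> w k < w i)"

text \<open>
  The first two summands give the last position of the subtree hanging to the right of \<open>i\<close>;
  the third discards the positions before it that are read only later.
\<close>

definition postorder :: "(int \<Rightarrow> int) \<Rightarrow> int \<Rightarrow> int" where
  "postorder w i = i + int (card {j. dominates w i j}) - int (card {j. dominates w j i})"

lemma dominates_trans: "dominates w i j \<Longrightarrow> dominates w j k \<Longrightarrow> dominates w i k"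
  unfolding dominates_def by (metis (no_types, lifting) order.strict_trans le_cases not_le order_refl)

lemma dominates_shift:
  assumes w: "periodic_bij n w"
  shows "dominates w (i + int n) (j + int n) \<longleftrightarrow> dominates w i j"
proof -
  have s: "w (k + int n) = w k + int n" for k using w by (simp add: periodic_bij_def)
  have "(\<forall>k. i + int n < k \<and> k \<le> j + int n \<longrightarrow> w k < w i + int n) \<longleftrightarrow>
      (\<forall>k. i < k \<and> k \<le> j \<longrightarrow> w k < w i)" (is "?l \<longleftrightarrow> ?r")
  proof
    assume l: ?l
    show ?r
    proof (intro allI impI)
      fix k assume "i < k \<and> k \<le> j"
      then have "w (k + int n) < w i + int n" using l by simp
      then show "w k < w i" by (simp add: s)
    qed
  next
    assume r: ?r
    show ?l
    proof (intro allI impI)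
      fix k assume "i + int n < k \<and> k \<le> j + int n"
      then have "w (k - int n) < w i" using r by simp
      then show "w k < w i + int n" using s[of "k - int n"] by simp
    qed
  qed
  then show ?thesis by (simp add: dominates_def s)
qed

text \<open>\<open>w (i + int n)\<close> exceeds \<open>w i\<close>, so there is a first later
  position with a larger value; the right subtree ends just before it.\<close>

lemma dominates_interval:
  assumes w: "periodic_bij n w" and n: "n \<ge> 1"
  obtains e where "i \<le> e" "{j. dominates w i j} = {i<..e}"
proof -
  let ?P = "\<lambda>d::nat. d > 0 \<and> w i < w (i + int d)"
  define d where "d = (LEAST d. ?P d)"
  have "?P n" using w n by (simp add: periodic_bij_def)
  then have d: "?P d" unfolding d_def by (rule LeastI)
  have below: "w k < w i" if "i < k" "k < i + int d" for k
  proof -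
    have "nat (k - i) < d" using that by linarith
    then have "\<not> ?P (nat (k - i))" unfolding d_def by (rule not_less_Least)
    then have "w k \<le> w i" using that by simp
    moreover have "w k \<noteq> w i" using periodic_bij_eq_iff[OF w] that by simp
    ultimately show ?thesis by simp
  qed
  have "dominates w i j \<longleftrightarrow> j \<in> {i<..i + int d - 1}" for j
  proof
    assume j: "dominates w i j"
    have "\<not> i + int d \<le> j"
    proof
      assume "i + int d \<le> j"
      then have "w (i + int d) < w i" using j d by (simp add: dominates_def)
      then show False using d by simp
    qed
    then show "j \<in> {i<..i + int d - 1}" using j by (simp add: dominates_def)
  next
    assume "j \<in> {i<..i + int d - 1}"
    then show "dominates w i j" using below by (simp add: dominates_def)
  qed
  then have "{j. dominates w i j} = {i<..i + int d - 1}" by blast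
  moreover have "i \<le> i + int d - 1" using d by simp
  ultimately show ?thesis using that by blast
qed

lemma dominates_bounded:
  assumes w: "periodic_bij n w" and n: "n \<ge> 1"
  obtains D where "\<And>i j. dominates w i j \<Longrightarrow> j - i \<le> D"
proof -
  obtain C where C: "\<And>i. \<bar>w i - i\<bar> \<le> C" using displacement_bounded[OF w n] by blast
  have "j - i \<le> 2 * C" if "dominates w i j" for i j
  proof -
    have "w j < w i" using that by (simp add: dominates_def)
    then show ?thesis using C[of i] C[of j] by linarith
  qed
  then show ?thesis using that by blast
qed

lemma finite_dominators:
  assumes w: "periodic_bij n w" and n: "n \<ge> 1"
  shows "finite {j. dominates w j i}"
proof -
  obtain D where D: "\<And>i j. dominates w i j \<Longrightarrow> j - i \<le> D" using dominates_bounded[OF w n] by blast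
  have "{j. dominates w j i} \<subseteq> {i - D..i}"
    using D by (force simp: dominates_def)
  then show ?thesis by (rule finite_subset) simp
qed

text \<open>With \<open>e\<close> the end of the right subtree of \<open>i\<close>, the rank is
  \<open>e\<close> minus the number of dominators of \<open>i\<close>. Passing from \<open>i\<close>
  down to \<open>j\<close> does not increase the end and adds at least the dominator
  \<open>i\<close>.\<close>

lemma postorder_greater:
  assumes w: "periodic_bij n w" and n: "n \<ge> 1" and d: "dominates w i j"
  shows "postorder w j < postorder w i"
proof -
  obtain e where e: "i \<le> e" "{j. dominates w i j} = {i<..e}" using dominates_interval[OF w n] .
  obtain f where f: "j \<le> f" "{k. dominates w j k} = {j<..f}" using dominates_interval[OF w n] .
  have "f \<le> e"
  proof (cases "f = j")
    case True
    then show ?thesis using d e by auto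
  next
    case False
    then have "dominates w i f" using f d dominates_trans by fastforce
    then show ?thesis using e by auto
  qed
  have "insert i {k. dominates w k i} \<subseteq> {k. dominates w k j}"
    using d dominates_trans by blast
  then have "card (insert i {k. dominates w k i}) \<le> card {k. dominates w k j}"
    by (rule card_mono[OF finite_dominators[OF w n]])
  moreover have "\<not> dominates w i i" by (simp add: dominates_def)
  ultimately have "card {k. dominates w k i} < card {k. dominates w k j}"
    using finite_dominators[OF w n, of i] by simp
  then show ?thesis using e f \<open>f \<le> e\<close> by (simp add: postorder_def)
qed

text \<open>The dominators of \<open>j\<close> that do not dominate \<open>i\<close> all lie
  strictly between \<open>e\<close> and \<open>j\<close>, so there are fewer of them than
  \<open>f - e\<close>, where \<open>f \<ge> j\<close>.\<close>

lemma postorder_less: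
  assumes w: "periodic_bij n w" and n: "n \<ge> 1" and ij: "i < j" and d: "\<not> dominates w i j"
  shows "postorder w i < postorder w j"
proof -
  obtain e where e: "i \<le> e" "{j. dominates w i j} = {i<..e}" using dominates_interval[OF w n] .
  obtain f where f: "j \<le> f" "{k. dominates w j k} = {j<..f}" using dominates_interval[OF w n] .
  have ej: "e < j" using d e ij by fastforce
  obtain m where m: "i < m" "m \<le> j" "w i < w m"
    using d ij periodic_bij_eq_iff[OF w] unfolding dominates_def by (metis linorder_neqE less_irrefl)
  have "{k. dominates w k j} \<subseteq> {k. dominates w k i} \<union> {e<..<j}"
  proof
    fix x assume "x \<in> {k. dominates w k j}"
    then have x: "dominates w x j" by simp
    have "x \<noteq> i" using x d by blast
    then consider "x < i" | "i < x" "x \<le> e" | "e < x" by linarith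
    then show "x \<in> {k. dominates w k i} \<union> {e<..<j}"
    proof cases
      case 1
      then show ?thesis using x ij by (auto simp: dominates_def)
    next
      case 2
      \<comment> \<open>A dominator of \<open>j\<close> inside the right subtree of \<open>i\<close>
        would exceed \<open>w m\<close>, which exceeds \<open>w i\<close>.\<close>
      then have "dominates w i x" using e by auto
      then have xi: "w x < w i" by (simp add: dominates_def)
      have "x < m"
      proof (rule ccontr)
        assume "\<not> x < m"
        then have "w m < w i" using \<open>dominates w i x\<close> m by (simp add: dominates_def)
        then show False using m by simp
      qed
      then have "w m < w x" using x m by (simp add: dominates_def)
      then show ?thesis using xi m by simp
    next
      case 3
      then show ?thesis using x by (simp add: dominates_def)
    qed
  qed
  then have "card {k. dominates w k j} \<le> card ({k. dominates w k i} \<union> {e<..<j})"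
    by (intro card_mono) (simp_all add: finite_dominators[OF w n])
  also have "\<dots> \<le> card {k. dominates w k i} + card {e<..<j}" by (rule card_Un_le)
  finally have "int (card {k. dominates w k j}) \<le> int (card {k. dominates w k i}) + (j - e - 1)"
    using ej by simp
  then show ?thesis using e f by (simp add: postorder_def)
qed

lemma postorder_less_iff:
  assumes w: "periodic_bij n w" and n: "n \<ge> 1" and ij: "i < j"
  shows "postorder w j < postorder w i \<longleftrightarrow> dominates w i j"
    and "postorder w i < postorder w j \<longleftrightarrow> \<not> dominates w i j"
  using postorder_greater[OF w n] postorder_less[OF w n ij] by (meson less_asym)+

lemma periodic_bij_postorder:
  assumes w: "periodic_bij n w" and n: "n \<ge> 1"
  shows "periodic_bij n (postorder w)"
proof (rule periodic_bij_if_inj[OF _ _ n])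
  show "inj (postorder w)"
  proof (rule linorder_injI)
    fix i j :: int assume "i < j"
    then show "postorder w i \<noteq> postorder w j"
      using postorder_greater[OF w n, of i j] postorder_less[OF w n, of i j] by fastforce
  qed
next
  fix i
  have "{j. dominates w (i + int n) j} = (\<lambda>j. j + int n) ` {j. dominates w i j}"
  proof (intro equalityI subsetI)
    fix j assume "j \<in> {j. dominates w (i + int n) j}"
    then have "dominates w i (j - int n)" using dominates_shift[OF w, of i "j - int n"] by simp
    then show "j \<in> (\<lambda>j. j + int n) ` {j. dominates w i j}" by force
  qed (auto simp: dominates_shift[OF w])
  moreover have "{j. dominates w j (i + int n)} = (\<lambda>j. j + int n) ` {j. dominates w j i}"
  proof (intro equalityI subsetI)
    fix j assume "j \<in> {j. dominates w j (i + int n)}"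
    then have "dominates w (j - int n) i" using dominates_shift[OF w, of "j - int n" i] by simp
    then show "j \<in> (\<lambda>j. j + int n) ` {j. dominates w j i}" by force
  qed (auto simp: dominates_shift[OF w])
  ultimately show "postorder w (i + int n) = postorder w i + int n"
    by (simp add: postorder_def card_image)
qed

text \<open>Sort the dominating pairs by their difference \<open>d\<close>: translation by
  \<open>d\<close> shows that as many start in the window as end in it. So the two corrections in
  \<open>postorder\<close> cancel over a period.\<close>

lemma postorder_affine_perms:
  assumes w: "periodic_bij n w" and n: "n \<ge> 1"
  shows "postorder w \<in> affine_perms n"
proof -
  obtain D where D: "\<And>i j. dominates w i j \<Longrightarrow> j - i \<le> D" using dominates_bounded[OF w n] by blast
  have out: "int (card {j. dominates w i j}) = (\<Sum>d\<in>{1..D}. of_bool (dominates w i (i + d)))" for i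
  proof -
    have "{j. dominates w i j} = (\<lambda>d. i + d) ` ({1..D} \<inter> {d. dominates w i (i + d)})"
    proof (intro equalityI subsetI)
      fix j assume "j \<in> {j. dominates w i j}"
      then have "j - i \<in> {1..D} \<inter> {d. dominates w i (i + d)}"
        using D[of i j] by (auto simp: dominates_def)
      then show "j \<in> (\<lambda>d. i + d) ` ({1..D} \<inter> {d. dominates w i (i + d)})" by force
    qed auto
    then show ?thesis by (simp add: card_image)
  qed
  have inn: "int (card {j. dominates w j i}) = (\<Sum>d\<in>{1..D}. of_bool (dominates w (i - d) i))" for i
  proof -
    have "{j. dominates w j i} = (\<lambda>d. i - d) ` ({1..D} \<inter> {d. dominates w (i - d) i})"
    proof (intro equalityI subsetI)
      fix j assume "j \<in> {j. dominates w j i}"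
      then have "i - j \<in> {1..D} \<inter> {d. dominates w (i - d) i}"
        using D[of j i] by (auto simp: dominates_def)
      then show "j \<in> (\<lambda>d. i - d) ` ({1..D} \<inter> {d. dominates w (i - d) i})" by force
    qed auto
    moreover have "inj_on (\<lambda>d. i - d) A" for A by (auto simp: inj_on_def)
    ultimately show ?thesis by (simp add: card_image)
  qed
  have swap: "(\<Sum>i\<in>{1..int n}. of_bool (dominates w (i - d) i)) =
      (\<Sum>i\<in>{1..int n}. of_bool (dominates w i (i + d)) :: int)" for d
  proof -
    have "periodic_bij n (\<lambda>i. i - d)"
      by (rule periodic_bij_if_inj[OF _ _ n]) (auto simp: inj_def)
    moreover have "dominates w (i + int n) (i + int n + d) = dominates w i (i + d)" for i
      using dominates_shift[OF w, of i "i + d"] by (simp add: algebra_simps)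
    ultimately show ?thesis
      using sum_periodic_reindex[of n "\<lambda>i. i - d" "\<lambda>i. of_bool (dominates w i (i + d)) :: int"] n by simp
  qed
  have "(\<Sum>i\<in>{1..int n}. int (card {j. dominates w j i})) =
      (\<Sum>i\<in>{1..int n}. int (card {j. dominates w i j}))"
    unfolding out inn by (subst (1 2) sum.swap) (simp only: swap)
  then have "(\<Sum>i\<in>{1..int n}. postorder w i) = (\<Sum>i\<in>{1..int n}. i)"
    by (simp add: postorder_def sum.distrib sum_subtractf)
  then show ?thesis
    using periodic_bij_postorder[OF w n] id_affine_perms[of n] by (simp add: affine_perms_iff)
qed

section \<open>The postorder ranking as least element of its class\<close>

text \<open>If nothing strictly between exceeds the larger end value, that value is the maximum of
  the whole interval, strict by injectivity.\<close>

lemma pos_le_iff: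
  assumes "inj w"
  shows "pos_le w i j \<longleftrightarrow>
    i = j \<or> (\<forall>k. min i j \<le> k \<and> k \<le> max i j \<and> k \<noteq> j \<longrightarrow> w k < w j)"
proof (cases "i = j")
  case False
  have "pos_le w i j \<longleftrightarrow> w i < w j \<and> (\<forall>k. min i j < k \<and> k < max i j \<longrightarrow> w k \<le> w j)"
  proof (cases "w i < w j")
    case True
    then have "max (w i) (w j) = w j" by simp
    then show ?thesis
      using True False unfolding pos_le_def pos_incomparable_def by (metis not_less)
  qed (use False in \<open>simp add: pos_le_def\<close>)
  also have "\<dots> \<longleftrightarrow> (\<forall>k. min i j \<le> k \<and> k \<le> max i j \<and> k \<noteq> j \<longrightarrow> w k < w j)" (is "?l \<longleftrightarrow> ?r")
  proof
    assume l: ?l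
    show ?r
    proof (intro allI impI)
      fix k assume k: "min i j \<le> k \<and> k \<le> max i j \<and> k \<noteq> j"
      show "w k < w j"
      proof (cases "k = i")
        case False
        then have "min i j < k \<and> k < max i j" using k by (auto simp: min_def max_def split: if_splits)
        then have "w k \<le> w j" using l by blast
        moreover have "w k \<noteq> w j" using k assms by (simp add: inj_eq)
        ultimately show ?thesis by simp
      qed (use l in simp)
    qed
  next
    assume r: ?r
    then have "w i < w j" using False by simp
    moreover have "w k \<le> w j" if "min i j < k \<and> k < max i j" for k
      using r that by (cases "k = j") (auto simp: less_imp_le)
    ultimately show ?l by blast
  qed
  finally show ?thesis using False by simp
qed (simp add: pos_le_def)

lemma pos_le_dominates:
  assumes "inj w" "j < i"
  shows "pos_le w i j \<longleftrightarrow> dominates w j i"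
  using assms by (auto simp: pos_le_iff dominates_def)

lemma pos_le_postorder:
  assumes w: "periodic_bij n w" and n: "n \<ge> 1"
  shows "pos_le (postorder w) = pos_le w"
proof (intro ext)
  fix i j :: int
  let ?u = "postorder w"
  have iw: "inj w" using w by (simp add: periodic_bij_def bij_def)
  have iu: "inj ?u" using periodic_bij_postorder[OF w n] by (simp add: periodic_bij_def bij_def)
  consider "i = j" | "j < i" | "i < j" by linarith
  then show "pos_le ?u i j = pos_le w i j"
  proof cases
    case 1
    then show ?thesis by (simp add: pos_le_def)
  next
    case 2
    \<comment> \<open>The positions dominated by \<open>j\<close> form an interval starting at
      \<open>j + 1\<close>, so domination of \<open>i\<close> includes that of everything before
      it.\<close>
    have "dominates ?u j i \<longleftrightarrow> (\<forall>k. j < k \<and> k \<le> i \<longrightarrow> dominates w j k)"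
      using 2 postorder_less_iff(1)[OF w n] by (auto simp: dominates_def[of ?u])
    also have "\<dots> \<longleftrightarrow> dominates w j i"
      using 2 by (auto simp: dominates_def)
    finally show ?thesis using 2 by (simp add: pos_le_dominates iu iw)
  next
    case 3
    have "(\<forall>k. i \<le> k \<and> k < j \<longrightarrow> \<not> dominates w k j) \<longleftrightarrow> (\<forall>k. i \<le> k \<and> k < j \<longrightarrow> w k < w j)"
      (is "?l \<longleftrightarrow> ?r")
    proof
      assume l: ?l
      show ?r
      proof (rule ccontr)
        assume "\<not> ?r"
        then obtain k where k: "i \<le> k" "k < j" "w j \<le> w k" by force
        \<comment> \<open>The maximum on \<open>{i..j}\<close>, if not attained at \<open>j\<close>,
          is attained at a dominator of \<open>j\<close>.\<close>
        let ?M = "Max (w ` {i..j})"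
        have "?M \<in> w ` {i..j}" using 3 by (intro Max_in) auto
        then obtain x where x: "x \<in> {i..j}" "w x = ?M" by auto
        have le: "w y \<le> w x" if "y \<in> {i..j}" for y using that x by simp
        have "w k \<le> w x" using k by (intro le) simp
        then have "x \<noteq> j" using k periodic_bij_eq_iff[OF w, of k j] by auto
        have "dominates w x j"
          unfolding dominates_def
        proof (intro conjI allI impI)
          show "x < j" using x \<open>x \<noteq> j\<close> by simp
          fix y assume y: "x < y \<and> y \<le> j"
          then have "w y \<le> w x" using x by (intro le) simp
          moreover have "w y \<noteq> w x" using y periodic_bij_eq_iff[OF w] by simp
          ultimately show "w y < w x" by simp
        qed
        then show False using l x \<open>x \<noteq> j\<close> by auto
      qed
    next
      assume r: ?r
      show ?l
      proof (intro allI impI notI)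
        fix k assume k: "i \<le> k \<and> k < j" and "dominates w k j"
        then have "w j < w k" by (simp add: dominates_def)
        moreover have "w k < w j" using r k by blast
        ultimately show False by simp
      qed
    qed
    moreover have "(\<forall>k. i \<le> k \<and> k < j \<longrightarrow> ?u k < ?u j) \<longleftrightarrow>
        (\<forall>k. i \<le> k \<and> k < j \<longrightarrow> \<not> dominates w k j)"
      using postorder_less_iff(2)[OF w n] by blast
    moreover have "pos_le f i j \<longleftrightarrow> (\<forall>k. i \<le> k \<and> k < j \<longrightarrow> f k < f j)" if "inj f" for f :: "int \<Rightarrow> int"
      using 3 that by (auto simp: pos_le_iff)
    ultimately show ?thesis using iu iw by simp
  qed
qed

text \<open>The length results assume \<open>n \<ge> 2\<close>; for n = 1 triviality of the group
  takes their place.\<close>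

lemma affine_perms_one:
  assumes u: "u \<in> affine_perms 1" and v: "v \<in> affine_perms 1"
  shows "u = v"
proof (rule affine_perms_eq_if_order_eq[OF u v])
  fix x
  have "periodic_bij 1 (inv v)" using v periodic_bij_inv by (simp add: affine_perms_iff)
  then have "inv v (x + 1) = inv v x + 1" by (simp add: periodic_bij_def)
  then show "u (inv v x) < u (inv v (x + 1))"
    using u by (simp add: affine_perms_iff periodic_bij_def)
qed simp

lemma pi_down_eq_postorder:
  assumes wa: "w \<in> affine_perms n" and n: "n \<ge> 1"
  shows "pi_down n w = postorder w"
proof -
  let ?u = "postorder w"
  have w: "periodic_bij n w" using wa by (simp add: affine_perms_iff)
  have iw: "inj w" using w by (simp add: periodic_bij_def bij_def)
  have ua: "?u \<in> affine_perms n" by (rule postorder_affine_perms[OF w n])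
  have cls: "v \<in> affine_sylvester n `` {w} \<longleftrightarrow> v \<in> affine_perms n \<and> pos_le v = pos_le w" for v
    using wa by (auto simp: affine_sylvester_def)
  \<comment> \<open>Every other member of the class lies above \<open>?u\<close> and not below it,
    so \<open>?u\<close> is the only minimal element. The disjunct \<open>v = ?u\<close> covers n =
    1.\<close>
  have key: "left_weak_le n ?u v \<and> (left_weak_le n v ?u \<longrightarrow> v = ?u) \<or> v = ?u"
    if v: "v \<in> affine_perms n" "pos_le v = pos_le w" for v
  proof (cases "n = 1")
    case True
    then show ?thesis using affine_perms_one ua v by blast
  next
    case False
    then have n2: "n \<ge> 2" using n by simp
    \<comment> \<open>An inversion of \<open>?u\<close> is a relation of the common order that puts
      the right position below the left one, and \<open>v\<close> orders comparable positions by
      value.\<close>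
    have sub: "inversions ?u \<subseteq> inversions v"
    proof
      fix x assume x: "x \<in> inversions ?u"
      obtain i j where ij: "x = (i, j)" by fastforce
      then have "i < j" "?u j < ?u i" using x by (auto simp: inversions_def)
      then have "pos_le v j i"
        using v(2) postorder_less_iff(1)[OF w n] by (simp add: pos_le_dominates[OF iw])
      then show "x \<in> inversions v" using \<open>i < j\<close> ij by (auto simp: inversions_def pos_le_def)
    qed
    have len: "affine_length n (v \<circ> inv ?u) + ninv n ?u = ninv n v"
      by (rule affine_length_comp_inv[OF ua v(1) n2 sub])
    have "v = ?u" if "left_weak_le n v ?u"
    proof -
      \<comment> \<open>If \<open>v\<close> is below \<open>?u\<close>, this word from
        \<open>?u\<close> to \<open>v\<close> has no room for a letter.\<close>
      obtain ws where ws: "ninv n v = length ws + ninv n ?u" "v = foldr (\<circ>) ws id \<circ> ?u"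
        using inversions_subset_word[OF ua n2 v(1) sub] by blast
      have "ninv n v \<le> ninv n ?u"
        using that v(1) ua n2 by (simp add: left_weak_le_def affine_length_eq_ninv)
      then show ?thesis using ws by simp
    qed
    moreover have "left_weak_le n ?u v"
      using len v(1) ua n2 by (simp add: left_weak_le_def affine_length_eq_ninv)
    ultimately show ?thesis by blast
  qed
  have mem: "?u \<in> affine_sylvester n `` {w}" using ua pos_le_postorder[OF w n] cls by blast
  show ?thesis
    unfolding pi_down_def
  proof (rule the_equality)
    show "?u \<in> affine_sylvester n `` {w} \<and>
        (\<forall>v\<in>affine_sylvester n `` {w}. left_weak_le n v ?u \<longrightarrow> v = ?u)"
      using mem key cls by blast
  next
    fix v assume "v \<in> affine_sylvester n `` {w} \<and>
        (\<forall>v'\<in>affine_sylvester n `` {w}. left_weak_le n v' v \<longrightarrow> v' = v)"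
    then show "v = ?u" using mem key[of v] cls by metis
  qed
qed

section \<open>Counting descents\<close>

text \<open>\<open>affine_simple n j\<close> moves up only the residue of \<open>j\<close>.
  Descents, defined as reflections, can thus be counted by index.\<close>

lemma inj_on_affine_simple: "inj_on (affine_simple n) {1..int n}"
proof (rule inj_onI)
  fix i j assume ij: "i \<in> {1..int n}" "j \<in> {1..int n}" and eq: "affine_simple n i = affine_simple n j"
  have "affine_simple n j i = i + 1" using fun_cong[OF eq, of i] by (simp add: affine_simple_def)
  then have "i mod int n = j mod int n" by (auto simp: affine_simple_def split: if_splits)
  then obtain m where m: "i = j + int n * m" by (rule mod_eq_obtain)
  then have "m = 0" using ij interval_shift_unique[of j n m] by simp
  then show "i = j" using m by simp
qed

lemma card_right_descents:
  "card (right_descents n f) = card {a \<in> {1..int n}. f (a + 1) < f a}"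
proof -
  have "right_descents n f = affine_simple n ` {a \<in> {1..int n}. f (a + 1) < f a}"
    by (auto simp: right_descents_def)
  moreover have "inj_on (affine_simple n) {a \<in> {1..int n}. f (a + 1) < f a}"
    by (rule inj_on_subset[OF inj_on_affine_simple]) auto
  ultimately show ?thesis by (simp add: card_image)
qed

text \<open>\<open>i\<close> and \<open>j\<close> are read consecutively. A neighbour of
  \<open>j\<close> with a smaller value would be read before \<open>j\<close>, yet after
  \<open>i\<close>: some \<open>k\<close> with \<open>i < k < j\<close> has a value above
  \<open>w i\<close> and cuts that neighbour off from the right subtree of \<open>i\<close>.\<close>

lemma descent_valley:
  assumes w: "periodic_bij n w" and n: "n \<ge> 1"
    and u: "postorder w j = postorder w i + 1" and less: "w j < w i"
  shows "w j < w (j - 1) \<and> w j < w (j + 1)"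
proof -
  let ?u = "postorder w"
  note lt = postorder_less_iff[OF w n]
  have "i \<noteq> j" using less by auto
  have ij: "i < j"
  proof (rule ccontr)
    assume "\<not> i < j"
    then have "j < i" using \<open>i \<noteq> j\<close> by simp
    then have "\<not> dominates w j i" using less by (auto simp: dominates_def)
    then show False using lt(2)[OF \<open>j < i\<close>] u by simp
  qed
  then have "\<not> dominates w i j" using lt(2)[OF ij] u by simp
  then obtain k where k: "i < k" "k \<le> j" "w i \<le> w k" using ij by (force simp: dominates_def)
  have "k \<noteq> j" using k less by auto
  have no: "\<not> dominates w i x" if "k \<le> x" for x
    using k that by (force simp: dominates_def)
  have left: "w j < w (j - 1)"
  proof (rule ccontr)
    assume "\<not> w j < w (j - 1)"
    then have "\<not> dominates w (j - 1) j" by (auto simp: dominates_def intro!: exI[of _ j])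
    then have "?u (j - 1) < ?u j" using lt(2)[of "j - 1" j] by simp
    moreover have "?u i < ?u (j - 1)"
      using lt(2)[of i "j - 1"] no[of "j - 1"] k \<open>k \<noteq> j\<close> by simp
    ultimately show False using u by simp
  qed
  have "w j < w (j + 1)"
  proof (rule ccontr)
    assume "\<not> w j < w (j + 1)"
    moreover have "w j \<noteq> w (j + 1)" using periodic_bij_eq_iff[OF w] by simp
    ultimately have "w (j + 1) < w j" by simp
    then have "dominates w j (j + 1)" by (auto simp: dominates_def zle_add1_eq_le order_class.le_less)
    then have "?u (j + 1) < ?u j" using lt(1)[of j "j + 1"] by simp
    moreover have "?u i < ?u (j + 1)" using lt(2)[of i "j + 1"] no[of "j + 1"] k by simp
    ultimately show False using u by simp
  qed
  with left show ?thesis ..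
qed

text \<open>The cyclic successor of a valley is never a valley, so valleys and their successors form
  disjoint sets of equal size.\<close>

lemma card_valleys_le:
  assumes w: "periodic_bij n w" and n: "n \<ge> 1"
  shows "card {j \<in> {1..int n}. w j < w (j - 1) \<and> w j < w (j + 1)} \<le> n div 2"
proof -
  let ?val = "\<lambda>j. w j < w (j - 1) \<and> w j < w (j + 1)"
  let ?V = "{j \<in> {1..int n}. ?val j}"
  let ?s = "\<lambda>j. if j = int n then 1 else j + 1"
  have per: "w (j + int n) = w j + int n" for j using w by (simp add: periodic_bij_def)
  have fin: "finite ?V" by (rule finite_subset[of _ "{1..int n}"]) auto
  have "inj_on ?s ?V" by (auto simp: inj_on_def)
  then have card: "card (?s ` ?V) = card ?V" by (rule card_image)
  have "?V \<inter> ?s ` ?V = {}"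
  proof (rule ccontr)
    assume "?V \<inter> ?s ` ?V \<noteq> {}"
    then obtain j where j: "?val j" "?val (?s j)" by blast
    show False
    proof (cases "j = int n")
      case True
      then show False using j per[of 0] per[of 1] by (simp add: add.commute)
    qed (use j in simp)
  qed
  then have "card ?V + card (?s ` ?V) = card (?V \<union> ?s ` ?V)"
    by (rule card_Un_disjoint[OF fin finite_imageI[OF fin], symmetric])
  also have "\<dots> \<le> card {1..int n}"
    using n by (intro card_mono) auto
  finally show ?thesis using card by simp
qed

lemma card_descents_stack_sort_le:
  assumes wa: "w \<in> affine_perms n" and n: "n \<ge> 1"
  shows "card (right_descents n (affine_stack_sort n w)) \<le> n div 2"
proof -
  let ?u = "postorder w"
  let ?f = "w \<circ> inv ?u"
  let ?val = "\<lambda>j. w j < w (j - 1) \<and> w j < w (j + 1)"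
  let ?D = "{a \<in> {1..int n}. ?f (a + 1) < ?f a}"
  have w: "periodic_bij n w" using wa by (simp add: affine_perms_iff)
  have u: "periodic_bij n ?u" by (rule periodic_bij_postorder[OF w n])
  \<comment> \<open>A descent \<open>a\<close> goes to the representative in the window of the
    position read at time \<open>a + 1\<close>.\<close>
  let ?g = "\<lambda>a. (inv ?u (a + 1) - 1) mod int n + 1"
  have "periodic_bij n (\<lambda>a. inv ?u (a + 1))"
    using periodic_bij_comp[OF periodic_bij_inv[OF u] periodic_bij_if_inj[of "\<lambda>a. a + 1" n]] n
    by (simp add: inj_def comp_def)
  then have "bij_betw ?g {1..int n} {1..int n}"
    using n by (intro bij_betw_residues) (auto simp: periodic_bij_def bij_def)
  then have inj: "inj_on ?g {1..int n}" by (rule bij_betw_imp_inj_on)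
  have "?g ` ?D \<subseteq> {j \<in> {1..int n}. ?val j}"
  proof
    fix x assume "x \<in> ?g ` ?D"
    then obtain a where a: "a \<in> ?D" "x = ?g a" by blast
    define j where "j = inv ?u (a + 1)"
    have "?val j"
      by (rule descent_valley[OF w n, of j "inv ?u a"])
        (use a in \<open>simp_all add: j_def periodic_bij_inv_eq[OF u]\<close>)
    moreover obtain m where "x = j + int n * m"
    proof
      show "x = j + int n * (- ((j - 1) div int n))"
        using a by (simp add: j_def minus_div_mult_eq_mod[symmetric] algebra_simps)
    qed
    moreover have "w (j + int n * m - 1) = w (j - 1) + int n * m"
      "w (j + int n * m + 1) = w (j + 1) + int n * m"
      using periodic_bij_shift[OF w, of "j - 1" m] periodic_bij_shift[OF w, of "j + 1" m]
      by (simp_all add: algebra_simps)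
    ultimately have "?val x" by (simp add: periodic_bij_shift[OF w])
    moreover have "x \<in> {1..int n}" using a n by (simp add: add1_zle_eq)
    ultimately show "x \<in> {j \<in> {1..int n}. ?val j}" by simp
  qed
  then have "card (?g ` ?D) \<le> card {j \<in> {1..int n}. ?val j}"
    by (rule card_mono[rotated]) (rule finite_subset[of _ "{1..int n}"], auto)
  also have "\<dots> \<le> n div 2" by (rule card_valleys_le[OF w n])
  finally have "card (?g ` ?D) \<le> n div 2" .
  moreover have "card (?g ` ?D) = card ?D"
    by (intro card_image inj_on_subset[OF inj]) auto
  ultimately show ?thesis
    by (simp add: affine_stack_sort_def pi_down_eq_postorder[OF wa n] card_right_descents)
qed

section \<open>A permutation attaining the bound\<close>

text \<open>Residue 0 separates the last valley of a period from the first one of the next, for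
  either parity of n.\<close>

definition zigzag_valley :: "nat \<Rightarrow> int \<Rightarrow> bool" where
  "zigzag_valley n j \<longleftrightarrow> odd (j mod int n) \<and> j mod int n < 2 * int (n div 2)"

text \<open>
  Multiples of \<open>n\<close> as displacements keep the map bijective; these two make the displacements
  over a period add up to \<open>0\<close>, and their difference \<open>n\<^sup>2\<close> puts valleys below all nearby
  other values.
\<close>

definition zigzag :: "nat \<Rightarrow> int \<Rightarrow> int" where
  "zigzag n j = j + int n * (if zigzag_valley n j then int (n div 2) - int n else int (n div 2))"

lemma zigzag_valley_shift: "zigzag_valley n (j + int n * m) = zigzag_valley n j"
  by (simp add: zigzag_valley_def)

text \<open>An odd residue is at least 1, so there is no wrap-around on the left; on the right it
  can only lead to residue 0, which is even.\<close>

lemma zigzag_valley_neighbours: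
  assumes j: "zigzag_valley n j" and n: "n \<ge> 1"
  shows "\<not> zigzag_valley n (j + 1)" "\<not> zigzag_valley n (j - 1)"
proof -
  define r where "r = j mod int n"
  have r: "odd r" "r < 2 * int (n div 2)" "r \<ge> 0"
    using j n by (auto simp: zigzag_valley_def r_def)
  have le: "2 * int (n div 2) \<le> int n" by linarith
  have "r \<ge> 1" using r by (cases "r = 0") auto
  have "(j - 1) mod int n = (r - 1) mod int n" by (simp add: r_def mod_diff_left_eq)
  also have "\<dots> = r - 1" using r le \<open>r \<ge> 1\<close> by simp
  finally show "\<not> zigzag_valley n (j - 1)" using r by (simp add: zigzag_valley_def)
  have "(j + 1) mod int n = (r + 1) mod int n" by (simp add: r_def mod_add_left_eq)
  moreover have "(r + 1) mod int n = (if r + 1 = int n then 0 else r + 1)"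
    using r le by simp
  ultimately show "\<not> zigzag_valley n (j + 1)" using r by (auto simp: zigzag_valley_def split: if_splits)
qed

lemma zigzag_valleys:
  assumes "n \<ge> 1"
  shows "card {j \<in> {1..int n}. zigzag_valley n j} = n div 2"
proof -
  have "{j \<in> {1..int n}. zigzag_valley n j} = (\<lambda>t. 2 * int t + 1) ` {..<n div 2}"
  proof (intro equalityI subsetI)
    fix j assume j: "j \<in> {j \<in> {1..int n}. zigzag_valley n j}"
    then have "j \<noteq> int n" by (auto simp: zigzag_valley_def)
    then have "j mod int n = j" using j by simp
    then have "odd j" "j < 2 * int (n div 2)" using j by (auto simp: zigzag_valley_def)
    then obtain t where t: "j = 2 * t + 1" by (auto elim: oddE)
    then have "j = 2 * int (nat t) + 1" "nat t < n div 2" using j \<open>j < 2 * int (n div 2)\<close> by auto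
    then show "j \<in> (\<lambda>t. 2 * int t + 1) ` {..<n div 2}" by blast
  next
    fix j assume "j \<in> (\<lambda>t. 2 * int t + 1) ` {..<n div 2}"
    then obtain t where t: "j = 2 * int t + 1" "t < n div 2" by auto
    then have "j < 2 * int (n div 2)" "2 * int (n div 2) \<le> int n" by linarith+
    then show "j \<in> {j \<in> {1..int n}. zigzag_valley n j}" using t by (simp add: zigzag_valley_def)
  qed
  moreover have "inj_on (\<lambda>t. 2 * int t + 1) {..<n div 2}" by (auto simp: inj_on_def)
  ultimately show ?thesis by (simp add: card_image)
qed

lemma zigzag_affine_perms:
  assumes n: "n \<ge> 1"
  shows "zigzag n \<in> affine_perms n"
proof -
  let ?k = "int (n div 2)"
  let ?m = "\<lambda>j. if zigzag_valley n j then ?k - int n else ?k"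
  have v: "zigzag_valley n (j + int n) = zigzag_valley n j" for j
    using zigzag_valley_shift[of n j 1] by simp
  have inj: "inj (zigzag n)"
  proof (rule injI)
    fix i j assume eq: "zigzag n i = zigzag n j"
    \<comment> \<open>Images are congruent to their arguments, so equal images come from congruent
      positions, which have the same displacement.\<close>
    then have "i = j + int n * (?m j - ?m i)" unfolding zigzag_def by (simp only: right_diff_distrib)
    then have "zigzag_valley n i = zigzag_valley n j" using zigzag_valley_shift by metis
    then show "i = j" using eq by (simp add: zigzag_def)
  qed
  have "periodic_bij n (zigzag n)"
    by (rule periodic_bij_if_inj[OF inj _ n]) (simp add: zigzag_def v)
  moreover have "(\<Sum>j\<in>{1..int n}. ?m j) = 0"
  proof -
    have "(\<Sum>j\<in>{1..int n}. ?m j) = (\<Sum>j\<in>{1..int n}. ?k - int n * of_bool (zigzag_valley n j))"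
      by (intro sum.cong) auto
    also have "\<dots> = int n * ?k - int n * (\<Sum>j\<in>{1..int n}. of_bool (zigzag_valley n j))"
      by (simp add: sum_subtractf sum_distrib_left)
    also have "(\<Sum>j\<in>{1..int n}. of_bool (zigzag_valley n j)) = ?k"
    proof -
      have "{1..int n} \<inter> {j. zigzag_valley n j} = {j \<in> {1..int n}. zigzag_valley n j}" by auto
      then show ?thesis
        using zigzag_valleys[OF n] by (simp only: sum_of_bool_eq finite_atLeastAtMost_int)
    qed
    finally show ?thesis by simp
  qed
  then have "(\<Sum>j\<in>{1..int n}. zigzag n j) = (\<Sum>j\<in>{1..int n}. j)"
    unfolding zigzag_def by (simp add: sum.distrib sum_distrib_left[symmetric])
  ultimately show ?thesis using id_affine_perms[of n] by (simp add: affine_perms_iff)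
qed

text \<open>On non-valleys \<open>zigzag n\<close> is increasing, so each of them left of
  \<open>j - 1\<close> is read before \<open>j\<close>, whereas \<open>j - 1\<close> itself is read
  after \<open>j\<close>. If \<open>i\<close> were a valley, \<open>i - 1\<close> would be read
  between \<open>i\<close> and \<open>j\<close>; if it were further left than
  \<open>j - int n - 1\<close>, so would \<open>i + int n\<close>. Hence \<open>i\<close> is a
  nearby non-valley.\<close>

lemma zigzag_descent:
  assumes n: "n \<ge> 1" and j: "zigzag_valley n j"
    and i: "postorder (zigzag n) j = postorder (zigzag n) i + 1"
  shows "zigzag n j < zigzag n i"
proof -
  let ?w = "zigzag n" and ?u = "postorder (zigzag n)" and ?k = "int (n div 2)"
  have w: "periodic_bij n ?w" using zigzag_affine_perms[OF n] by (simp add: affine_perms_iff)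
  note lt = postorder_less_iff[OF w n]
  have "n \<noteq> 1" using j by (auto simp: zigzag_valley_def)
  then have n2: "n \<ge> 2" using n by simp
  have nn: "2 * int n \<le> int n * int n" using n2 by (intro mult_right_mono) auto
  have val: "?w x = x + int n * ?k - int n * int n" if "zigzag_valley n x" for x
    using that by (simp add: zigzag_def algebra_simps)
  have nval: "?w x = x + int n * ?k" if "\<not> zigzag_valley n x" for x
    using that by (simp add: zigzag_def)
  have before: "?u x < ?u (x - 1)" if x: "zigzag_valley n x" for x
  proof -
    have "?w x < ?w (x - 1)" using val[OF x] nval[OF zigzag_valley_neighbours(2)[OF x n]] nn n2
      by linarith
    then have "dominates ?w (x - 1) x" by (auto simp: dominates_def dest: order_antisym)
    then show ?thesis using lt(1)[of "x - 1" x] by simp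
  qed
  have earlier: "?u x < ?u j" if x: "x < j - 1" "\<not> zigzag_valley n x" for x
  proof -
    have "?w x < ?w (j - 1)" using nval[OF x(2)] nval[OF zigzag_valley_neighbours(2)[OF j n]] x by simp
    then have "\<not> dominates ?w x j" using x by (force simp: dominates_def)
    then show ?thesis using lt(2)[of x j] x by simp
  qed
  have "\<not> j < i"
  proof
    assume ji: "j < i"
    then have "dominates ?w j i" using lt(1)[OF ji] i by simp
    then have "?w (j + 1) < ?w j" using ji by (simp add: dominates_def)
    then show False
      using val[OF j] nval[OF zigzag_valley_neighbours(1)[OF j n]] nn by simp
  qed
  moreover have "i \<noteq> j" "i \<noteq> j - 1" using i before[OF j] by auto
  ultimately have ij: "i < j - 1" by simp
  have iv: "\<not> zigzag_valley n i"
  proof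
    assume v: "zigzag_valley n i"
    have "?u (i - 1) < ?u j"
      using ij by (intro earlier zigzag_valley_neighbours(2)[OF v n]) simp
    then show False using before[OF v] i by simp
  qed
  have "j - int n - 1 \<le> i"
  proof (rule ccontr)
    assume "\<not> j - int n - 1 \<le> i"
    moreover have "\<not> zigzag_valley n (i + int n)" using iv zigzag_valley_shift[of n i 1] by simp
    ultimately have "?u (i + int n) < ?u j" by (intro earlier) simp_all
    moreover have "?u (i + int n) = ?u i + int n"
      using periodic_bij_postorder[OF w n] by (simp add: periodic_bij_def)
    ultimately show False using i n by simp
  qed
  \<comment> \<open>The depth n^2 is at least 2n, which exceeds the distance, at most n + 1, from
    \<open>i\<close> to \<open>j\<close>.\<close>
  then show ?thesis using val[OF j] nval[OF iv] nn n2 by linarith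
qed

lemma card_descents_zigzag:
  assumes n: "n \<ge> 1"
  shows "n div 2 \<le> card (right_descents n (affine_stack_sort n (zigzag n)))"
proof -
  let ?w = "zigzag n" and ?u = "postorder (zigzag n)"
  let ?f = "?w \<circ> inv ?u"
  let ?V = "{j \<in> {1..int n}. zigzag_valley n j}"
  let ?D = "{a \<in> {1..int n}. ?f (a + 1) < ?f a}"
  have wa: "?w \<in> affine_perms n" by (rule zigzag_affine_perms[OF n])
  then have w: "periodic_bij n ?w" by (simp add: affine_perms_iff)
  have u: "periodic_bij n ?u" by (rule periodic_bij_postorder[OF w n])
  have f: "periodic_bij n ?f" by (rule periodic_bij_comp[OF w periodic_bij_inv[OF u]])
  \<comment> \<open>One subtraction goes to the time before \<open>j\<close> is read; the other
    belongs to the choice of a representative in the window.\<close>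
  let ?g = "\<lambda>j. (?u j - 1 - 1) mod int n + 1"
  have "periodic_bij n (\<lambda>j. ?u j - 1)"
    using periodic_bij_comp[OF periodic_bij_if_inj[of "\<lambda>a. a - 1" n] u] n
    by (simp add: inj_def comp_def)
  then have "bij_betw ?g {1..int n} {1..int n}"
    using n by (intro bij_betw_residues) (auto simp: periodic_bij_def bij_def)
  then have inj: "inj_on ?g {1..int n}" by (rule bij_betw_imp_inj_on)
  have "?g ` ?V \<subseteq> ?D"
  proof
    fix x assume "x \<in> ?g ` ?V"
    then obtain j where j: "j \<in> ?V" "x = ?g j" by blast
    define a where "a = ?u j - 1"
    have "?w j < ?w (inv ?u a)"
      by (rule zigzag_descent[OF n]) (use j in \<open>simp_all add: a_def periodic_bij_inv_eq[OF u]\<close>)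
    then have "?f (a + 1) < ?f a" by (simp add: a_def periodic_bij_inv_eq[OF u])
    moreover obtain m where "x = a + int n * m"
    proof
      show "x = a + int n * (- ((a - 1) div int n))"
        using j by (simp add: a_def minus_div_mult_eq_mod[symmetric] algebra_simps)
    qed
    moreover have "?f (a + int n * m + 1) = ?f (a + 1) + int n * m"
      "?f (a + int n * m) = ?f a + int n * m"
      using periodic_bij_shift[OF f, of "a + 1" m] periodic_bij_shift[OF f, of a m]
      by (simp_all only: add_ac)
    ultimately have "?f (x + 1) < ?f x" by simp
    moreover have "x \<in> {1..int n}" using j n by (simp add: add1_zle_eq)
    ultimately show "x \<in> ?D" by simp
  qed
  then have "card (?g ` ?V) \<le> card ?D"
    by (rule card_mono[rotated]) (rule finite_subset[of _ "{1..int n}"], auto)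
  moreover have "card (?g ` ?V) = card ?V"
    by (intro card_image inj_on_subset[OF inj]) auto
  ultimately have "n div 2 \<le> card ?D" using zigzag_valleys[OF n] by linarith
  then show ?thesis
    by (simp add: affine_stack_sort_def pi_down_eq_postorder[OF wa n] card_right_descents)
qed

theorem theorem8p3:
  fixes n :: nat
  assumes "n \<ge> 1"
  shows "Max ((\<lambda>w. card (right_descents n (affine_stack_sort n w))) ` affine_perms n) = n div 2"
proof (rule Max_eqI)
  let ?c = "\<lambda>w. card (right_descents n (affine_stack_sort n w))"
  have le: "?c w \<le> n div 2" if "w \<in> affine_perms n" for w
    using that assms by (rule card_descents_stack_sort_le)
  \<comment> \<open>The group is infinite for \<open>n \<ge> 2\<close>; the bound makes the set of
    values finite, as \<open>Max\<close> requires.\<close>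
  then have "?c ` affine_perms n \<subseteq> {..n div 2}" by blast
  then show "finite (?c ` affine_perms n)" by (rule finite_subset) simp
  show "y \<le> n div 2" if "y \<in> ?c ` affine_perms n" for y using that le by blast
  have z: "zigzag n \<in> affine_perms n" by (rule zigzag_affine_perms[OF assms])
  then have "?c (zigzag n) = n div 2"
    using le card_descents_zigzag[OF assms] by (simp add: le_antisym)
  then show "n div 2 \<in> ?c ` affine_perms n" using z by (metis imageI)
qed

end
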